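(* Let $I$ be an index set and let $F:[0,+\infty)^I\to[0,+\infty)$ be a function. Consider the following statements: (1) $F$ is a strongly quasi-metric aggregation function on products; (2) $F$ is a strongly quasi-pseudometric aggregation function on products; (3) $F^{-1}(0)=\{0_I\}$, $F$ is subadditive, monotone and continuous at $0_I$; (4) $F$ is a strongly metric aggregation function on products; (5) $F$ is a strongly pseudometric aggregation function on products; (6) $F^{-1}(0)=\{0_I\}$, $F$ is continuous at $0_I$, and $(F(a),F(b),F(c))$ is a triangle triplet whenever $(a,b,c)$ is a triangle triplet in $[0,+\infty)^I$. Then $(1)\Leftrightarrow(2)\Leftrightarrow(3)\Longrightarrow(4)\Leftrightarrow(5)\Leftrightarrow(6)$.
   Context: A quasi-pseudometric on a nonempty set $X$ is a map $d:X\times X\to[0,+\infty)$ with $d(x,x)=0$ and $d(x,z)\le d(x,y)+d(y,z)$ for all $x,y,z$. It is a quasi-metric if moreover $d(x,y)=d(y,x)=0$ implies $x=y$; a pseudometric is a symmetric quasi-pseudometric; a metric is a symmetric quasi-metric. $\mathscr{T}(d)$ is the topology having the balls $B_d(x,\varepsilon)=\{y\in X: d(x,y)<\varepsilon\}$, $x\in X$, $\varepsilon>0$, as a base. Let $\mathcal K$ be one of the words metric, quasi-metric, pseudometric, quasi-pseudometric. For a family $\{(X_i,d_i):i\in I\}$ of $\mathcal K$ spaces define $d_\Pi:\prod_{i\in I}X_i\times\prod_{i\in I}X_i\to[0,+\infty)^I$ by $d_\Pi(x,y)=(d_i(x_i,y_i))_{i\in I}$. A function $F:[0,+\infty)^I\to[0,+\infty)$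 is a $\mathcal K$ aggregation function on products if $F\circ d_\Pi$ is a $\mathcal K$ on $\prod_{i\in I}X_i$ for every family $\{(X_i,d_i):i\in I\}$ of $\mathcal K$ spaces. It is a strongly $\mathcal K$ aggregation function on products if, in addition, for every such family the product topology satisfies $\prod_{i\in I}\mathscr{T}(d_i)=\mathscr{T}(F\circ d_\Pi)$. $0_I$ is the element of $[0,+\infty)^I$ with all coordinates zero; $[0,+\infty)^I$ carries the componentwise order and sum and the product topology of the usual topologies. $F$ is subadditive if $F(a+b)\le F(a)+F(b)$ for all $a,b$, and monotone if $a\le b$ implies $F(a)\le F(b)$. $(a,b,c)$ is a triangle triplet if $a\le b+c$, $b\le a+c$ and $c\le a+b$ (componentwise; the same definition is used in $[0,+\infty)$). *)

theory Defs
  imports "HOL-Analysis.Analysis"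
begin

section \<open>Metric-like spaces on a carrier set\<close>

text \<open>
  Only the values of the distance on the carrier matter. In particular no condition is
  imposed outside \<open>X\<close>, unlike in the locale \<^locale>\<open>Metric_space\<close>.
\<close>

definition quasi_pseudometric_on :: "'a set \<Rightarrow> ('a \<Rightarrow> 'a \<Rightarrow> real) \<Rightarrow> bool" where
  "quasi_pseudometric_on X d \<longleftrightarrow>
     X \<noteq> {} \<and>
     (\<forall>x\<in>X. \<forall>y\<in>X. 0 \<le> d x y) \<and>
     (\<forall>x\<in>X. d x x = 0) \<and>
     (\<forall>x\<in>X. \<forall>y\<in>X. \<forall>z\<in>X. d x z \<le> d x y + d y z)"

definition quasi_metric_on :: "'a set \<Rightarrow> ('a \<Rightarrow> 'a \<Rightarrow> real) \<Rightarrow> bool" where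
  "quasi_metric_on X d \<longleftrightarrow>
     quasi_pseudometric_on X d \<and> (\<forall>x\<in>X. \<forall>y\<in>X. d x y = 0 \<and> d y x = 0 \<longrightarrow> x = y)"

definition pseudometric_on :: "'a set \<Rightarrow> ('a \<Rightarrow> 'a \<Rightarrow> real) \<Rightarrow> bool" where
  "pseudometric_on X d \<longleftrightarrow>
     quasi_pseudometric_on X d \<and> (\<forall>x\<in>X. \<forall>y\<in>X. d x y = d y x)"

definition metric_on :: "'a set \<Rightarrow> ('a \<Rightarrow> 'a \<Rightarrow> real) \<Rightarrow> bool" where
  "metric_on X d \<longleftrightarrow>
     quasi_metric_on X d \<and> (\<forall>x\<in>X. \<forall>y\<in>X. d x y = d y x)"

datatype kind = Metric | Quasi_Metric | Pseudometric | Quasi_Pseudometric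

text \<open>
  A predicate passed as an argument could not be used both for the factors and for the
  product, whose points have a different type; hence the type of names \<open>kind\<close>.
\<close>

primrec is_space :: "kind \<Rightarrow> 'a set \<Rightarrow> ('a \<Rightarrow> 'a \<Rightarrow> real) \<Rightarrow> bool" where
  "is_space Metric = metric_on"
| "is_space Quasi_Metric = quasi_metric_on"
| "is_space Pseudometric = pseudometric_on"
| "is_space Quasi_Pseudometric = quasi_pseudometric_on"

definition dball :: "'a set \<Rightarrow> ('a \<Rightarrow> 'a \<Rightarrow> real) \<Rightarrow> 'a \<Rightarrow> real \<Rightarrow> 'a set" where
  "dball X d x e = {y \<in> X. d x y < e}"

definition dtopology :: "'a set \<Rightarrow> ('a \<Rightarrow> 'a \<Rightarrow> real) \<Rightarrow> 'a topology" where
  "dtopology X d = topology (arbitrary union_of (\<lambda>B. \<exists>x\<in>X. \<exists>e>0. B = dball X d x e))"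

text \<open>
  The unions of balls do form a topology whenever \<open>d\<close> is a quasi-pseudometric, so
  \<open>dtopology X d\<close> then has the expected open sets.
\<close>

lemma dball_refine:
  assumes "quasi_pseudometric_on X d" "x \<in> X" "y \<in> dball X d x e"
  shows "y \<in> X" "0 < e - d x y" "dball X d y (e - d x y) \<subseteq> dball X d x e"
proof -
  show y: "y \<in> X" and "0 < e - d x y"
    using assms(3) by (auto simp: dball_def)
  show "dball X d y (e - d x y) \<subseteq> dball X d x e"
  proof
    fix z assume "z \<in> dball X d y (e - d x y)"
    moreover from this have "z \<in> X"
      by (simp add: dball_def)
    with assms(1,2) y have "d x z \<le> d x y + d y z"
      unfolding quasi_pseudometric_on_def by blast
    ultimately show "z \<in> dball X d x e"
      by (simp add: dball_def)
  qed
qed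

lemma union_of_dball_iff:
  assumes "quasi_pseudometric_on X d"
  shows "(arbitrary union_of (\<lambda>B. \<exists>x\<in>X. \<exists>e>0. B = dball X d x e)) U \<longleftrightarrow>
           U \<subseteq> X \<and> (\<forall>x\<in>U. \<exists>e>0. dball X d x e \<subseteq> U)"
    (is "?L \<longleftrightarrow> ?R")
proof
  assume ?L
  then have *: "\<forall>x\<in>U. \<exists>V. (\<exists>z\<in>X. \<exists>e>0. V = dball X d z e) \<and> x \<in> V \<and> V \<subseteq> U"
    by (simp add: arbitrary_union_of_alt)
  show ?R
  proof (intro conjI ballI subsetI)
    fix x assume "x \<in> U"
    then obtain z e where z: "z \<in> X" "x \<in> dball X d z e" "dball X d z e \<subseteq> U"
      using * by blast
    note r = dball_refine[OF assms z(1,2)]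
    from r(1) show "x \<in> X" .
    show "\<exists>e>0. dball X d x e \<subseteq> U"
      using r(2,3) z(3) by (meson subset_trans)
  qed
next
  assume R: ?R
  have zero: "\<forall>x\<in>X. d x x = 0"
    using assms unfolding quasi_pseudometric_on_def by blast
  have "x \<in> dball X d x e" if "x \<in> X" "e > 0" for x e
    using that zero by (simp add: dball_def)
  then have "\<exists>V. (\<exists>z\<in>X. \<exists>e>0. V = dball X d z e) \<and> x \<in> V \<and> V \<subseteq> U" if "x \<in> U" for x
    using R that by blast
  then show ?L
    by (simp add: arbitrary_union_of_alt)
qed

lemma openin_dtopology:
  assumes "quasi_pseudometric_on X d"
  shows "openin (dtopology X d) U \<longleftrightarrow> U \<subseteq> X \<and> (\<forall>x\<in>U. \<exists>e>0. dball X d x e \<subseteq> U)"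
proof -
  have "istopology (\<lambda>U. U \<subseteq> X \<and> (\<forall>x\<in>U. \<exists>e>0. dball X d x e \<subseteq> U))"
    unfolding istopology_def
  proof (intro conjI allI impI)
    fix S T assume S: "S \<subseteq> X \<and> (\<forall>x\<in>S. \<exists>e>0. dball X d x e \<subseteq> S)"
      and T: "T \<subseteq> X \<and> (\<forall>x\<in>T. \<exists>e>0. dball X d x e \<subseteq> T)"
    show "S \<inter> T \<subseteq> X" using S by blast
    show "\<forall>x\<in>S \<inter> T. \<exists>e>0. dball X d x e \<subseteq> S \<inter> T"
    proof
      fix x assume "x \<in> S \<inter> T"
      then obtain e f where "e > 0" "f > 0" "dball X d x e \<subseteq> S" "dball X d x f \<subseteq> T"
        using S T by blast
      then show "\<exists>e>0. dball X d x e \<subseteq> S \<inter> T"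
        by (intro exI[of _ "min e f"]) (auto simp: dball_def)
    qed
  next
    fix \<K> assume K: "\<forall>K\<in>\<K>. K \<subseteq> X \<and> (\<forall>x\<in>K. \<exists>e>0. dball X d x e \<subseteq> K)"
    then show "\<Union> \<K> \<subseteq> X" by blast
    show "\<forall>x\<in>\<Union> \<K>. \<exists>e>0. dball X d x e \<subseteq> \<Union> \<K>"
    proof
      fix x assume "x \<in> \<Union> \<K>"
      then obtain K where "K \<in> \<K>" "x \<in> K" by blast
      with K obtain e where "e > 0" "dball X d x e \<subseteq> K" by blast
      with \<open>K \<in> \<K>\<close> show "\<exists>e>0. dball X d x e \<subseteq> \<Union> \<K>" by blast
    qed
  qed
  moreover have "(arbitrary union_of (\<lambda>B. \<exists>x\<in>X. \<exists>e>0. B = dball X d x e)) =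
      (\<lambda>U. U \<subseteq> X \<and> (\<forall>x\<in>U. \<exists>e>0. dball X d x e \<subseteq> U))"
    by (intro ext) (rule union_of_dball_iff[OF assms])
  ultimately show ?thesis
    by (simp add: dtopology_def topology_inverse')
qed

lemma (in Metric_space) dtopology_eq_mtopology:
  assumes "M \<noteq> {}"
  shows "metric_on M d" "dtopology M d = mtopology"
proof -
  show m: "metric_on M d"
    unfolding metric_on_def quasi_metric_on_def quasi_pseudometric_on_def
    using assms by (intro conjI ballI impI) (simp_all add: triangle commute)
  have b: "mball x e = dball M d x e" if "x \<in> M" for x e
    unfolding mball_def dball_def using that by blast
  have q: "quasi_pseudometric_on M d"
    using m unfolding metric_on_def quasi_metric_on_def by blast
  have "openin (dtopology M d) U \<longleftrightarrow> openin mtopology U" for U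
  proof (cases "U \<subseteq> M")
    case True
    then have "(\<forall>x\<in>U. \<exists>e>0. dball M d x e \<subseteq> U) \<longleftrightarrow> (\<forall>x\<in>U. \<exists>e>0. mball x e \<subseteq> U)"
      by (intro ball_cong refl) (simp only: b subsetD)
    then show ?thesis
      unfolding openin_dtopology[OF q] openin_mtopology by blast
  next
    case False
    then show ?thesis
      unfolding openin_dtopology[OF q] openin_mtopology by blast
  qed
  then show "dtopology M d = mtopology"
    by (simp add: topology_eq)
qed

section \<open>Aggregation functions on products\<close>

text \<open>
  \<open>nonneg_pow I\<close> is the set $[0,+\infty)^I$. Its elements, like those of all products here,
  are extensional functions (with value \<^const>\<open>undefined\<close> outside \<open>I\<close>), so that equality is
  equality of families indexed by \<open>I\<close>. The index set may be empty.
\<close>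

definition nonneg_pow :: "'i set \<Rightarrow> ('i \<Rightarrow> real) set" where
  "nonneg_pow I = (I \<rightarrow>\<^sub>E {0..})"

definition zero_pow :: "'i set \<Rightarrow> 'i \<Rightarrow> real" where
  "zero_pow I = (\<lambda>i\<in>I. 0)"

definition dprod ::
  "'i set \<Rightarrow> ('i \<Rightarrow> 'a \<Rightarrow> 'a \<Rightarrow> real) \<Rightarrow> ('i \<Rightarrow> 'a) \<Rightarrow> ('i \<Rightarrow> 'a) \<Rightarrow> 'i \<Rightarrow> real" where
  "dprod I d x y = (\<lambda>i\<in>I. d i (x i) (y i))"

text \<open>
  HOL cannot quantify over all families of sets. The type argument is the universe from which
  the points of the spaces \<open>X i\<close> are drawn: the \<open>X i\<close> range over arbitrary nonempty subsets of
  \<open>'a\<close>. Taking \<open>'a\<close> to be a type into which the disjoint union of a given family embeds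
  covers that family.
\<close>

definition aggregation_on_products ::
  "'a itself \<Rightarrow> kind \<Rightarrow> 'i set \<Rightarrow> (('i \<Rightarrow> real) \<Rightarrow> real) \<Rightarrow> bool" where
  "aggregation_on_products T K I F \<longleftrightarrow>
     (\<forall>(X :: 'i \<Rightarrow> 'a set) d. (\<forall>i\<in>I. is_space K (X i) (d i)) \<longrightarrow>
        is_space K (Pi\<^sub>E I X) (\<lambda>x y. F (dprod I d x y)))"

definition strongly_aggregation_on_products ::
  "'a itself \<Rightarrow> kind \<Rightarrow> 'i set \<Rightarrow> (('i \<Rightarrow> real) \<Rightarrow> real) \<Rightarrow> bool" where
  "strongly_aggregation_on_products T K I F \<longleftrightarrow>
     aggregation_on_products T K I F \<and>
     (\<forall>(X :: 'i \<Rightarrow> 'a set) d. (\<forall>i\<in>I. is_space K (X i) (d i)) \<longrightarrow>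
        product_topology (\<lambda>i. dtopology (X i) (d i)) I =
        dtopology (Pi\<^sub>E I X) (\<lambda>x y. F (dprod I d x y)))"

definition zero_preimage :: "'i set \<Rightarrow> (('i \<Rightarrow> real) \<Rightarrow> real) \<Rightarrow> ('i \<Rightarrow> real) set" where
  "zero_preimage I F = {a \<in> nonneg_pow I. F a = 0}"

definition subadditive_pow :: "'i set \<Rightarrow> (('i \<Rightarrow> real) \<Rightarrow> real) \<Rightarrow> bool" where
  "subadditive_pow I F \<longleftrightarrow>
     (\<forall>a\<in>nonneg_pow I. \<forall>b\<in>nonneg_pow I. F (\<lambda>i\<in>I. a i + b i) \<le> F a + F b)"

definition monotone_pow :: "'i set \<Rightarrow> (('i \<Rightarrow> real) \<Rightarrow> real) \<Rightarrow> bool" where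
  "monotone_pow I F \<longleftrightarrow> monotone_on (nonneg_pow I) (\<lambda>a b. \<forall>i\<in>I. a i \<le> b i) (\<le>) F"

definition continuous_at_zero_pow :: "'i set \<Rightarrow> (('i \<Rightarrow> real) \<Rightarrow> real) \<Rightarrow> bool" where
  "continuous_at_zero_pow I F \<longleftrightarrow>
     topcontinuous_at (product_topology (\<lambda>i. top_of_set {0..}) I) (top_of_set {0..}) F (zero_pow I)"

definition triangle_triplet :: "real \<Rightarrow> real \<Rightarrow> real \<Rightarrow> bool" where
  "triangle_triplet a b c \<longleftrightarrow> a \<le> b + c \<and> b \<le> a + c \<and> c \<le> a + b"

definition triangle_triplet_pow ::
  "'i set \<Rightarrow> ('i \<Rightarrow> real) \<Rightarrow> ('i \<Rightarrow> real) \<Rightarrow> ('i \<Rightarrow> real) \<Rightarrow> bool" where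
  "triangle_triplet_pow I a b c \<longleftrightarrow> (\<forall>i\<in>I. triangle_triplet (a i) (b i) (c i))"

definition preserves_triangle_triplets :: "'i set \<Rightarrow> (('i \<Rightarrow> real) \<Rightarrow> real) \<Rightarrow> bool" where
  "preserves_triangle_triplets I F \<longleftrightarrow>
     (\<forall>a\<in>nonneg_pow I. \<forall>b\<in>nonneg_pow I. \<forall>c\<in>nonneg_pow I.
        triangle_triplet_pow I a b c \<longrightarrow> triangle_triplet (F a) (F b) (F c))"

end

theory Submission
  imports Defs
begin

text \<open>
  A metric is a space of each of the four kinds, so any test family made of metric spaces may be
  used whatever the kind under consideration. Three test families carry the necessity of the
  conditions.

  A triangle triplet is the list of side lengths of a metric space with three (possibly
  coinciding) points; taking one such space for each index and applying the triangle inequality in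
  the product shows that an aggregation function of any kind preserves triangle triplets. If
  merely \<open>a \<le> b + c\<close>, there is still a quasi-metric space with three points in which these are
  the distances along \<open>x\<close>, \<open>y\<close>, \<open>z\<close>, the three backward distances being
  large. For the two asymmetric kinds this gives \<open>F a \<le> F b + F c\<close> whenever \<open>a \<le> b + c\<close>,
  that is, subadditivity and monotonicity.
  The two points at distance \<open>a i\<close> in each factor show that \<open>F a = 0\<close> forces \<open>a = 0\<close>, for
  otherwise the product topology would separate points that the aggregated distance does not.
  Finally, when every factor is the half-line of nonnegative rationals, the neighbourhoods of the
  origin in the product give continuity at zero along rational families. Real families are
  dominated by rational ones, and domination is controlled because \<open>(a, b, b)\<close> is a triangle
  triplet when \<open>a \<le> 2 b\<close>, so that \<open>F a \<le> 2 F b\<close>. Countable spaces suffice for all this,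
  which is why the points may be drawn from any infinite type.

  Conversely the algebraic conditions transfer the axioms of each kind to the product. Continuity
  at zero says that balls of the aggregated distance are neighbourhoods in the product topology.
  In the other direction, if \<open>a i \<ge> \<epsilon>\<close> then \<open>a\<close> dominates the family with the single nonzero
  entry \<open>\<epsilon>\<close> at \<open>i\<close>, hence \<open>F a\<close> is at least half the positive value of \<open>F\<close> there: small
  aggregated distance forces small distance in each factor.
\<close>

section \<open>Topologies of quasi-pseudometrics and their products\<close>

lemma quasi_pseudometric_onD:
  assumes "quasi_pseudometric_on X d"
  shows "X \<noteq> {}"
    and "\<lbrakk>x \<in> X; y \<in> X\<rbrakk> \<Longrightarrow> 0 \<le> d x y"
    and "x \<in> X \<Longrightarrow> d x x = 0"
    and "\<lbrakk>x \<in> X; y \<in> X; z \<in> X\<rbrakk> \<Longrightarrow> d x z \<le> d x y + d y z"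
  using assms unfolding quasi_pseudometric_on_def by blast+

lemma is_space_imp_quasi_pseudometric_on:
  "is_space K X d \<Longrightarrow> quasi_pseudometric_on X d"
  by (cases K) (auto simp: metric_on_def quasi_metric_on_def pseudometric_on_def)

lemma metric_on_imp_is_space: "metric_on X d \<Longrightarrow> is_space K X d"
  by (cases K) (auto simp: metric_on_def quasi_metric_on_def pseudometric_on_def)

lemma quasi_metric_on_imp_is_space:
  assumes "quasi_metric_on X d" "K \<in> {Quasi_Metric, Quasi_Pseudometric}"
  shows "is_space K X d"
  using assms by (auto simp: quasi_metric_on_def)

lemma topspace_dtopology:
  assumes "quasi_pseudometric_on X d"
  shows "topspace (dtopology X d) = X"
proof
  show "topspace (dtopology X d) \<subseteq> X"
    using openin_dtopology[OF assms] by (metis openin_topspace)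
  have "openin (dtopology X d) X"
    unfolding openin_dtopology[OF assms] by (auto simp: dball_def intro: exI[of _ 1])
  then show "X \<subseteq> topspace (dtopology X d)"
    by (rule openin_subset)
qed

lemma openin_dball:
  assumes "quasi_pseudometric_on X d" "x \<in> X"
  shows "openin (dtopology X d) (dball X d x e)"
  unfolding openin_dtopology[OF assms(1)]
proof (intro conjI ballI)
  show "dball X d x e \<subseteq> X" by (auto simp: dball_def)
  show "\<exists>e'>0. dball X d y e' \<subseteq> dball X d x e" if "y \<in> dball X d x e" for y
    using dball_refine(2,3)[OF assms that] by blast
qed

lemma centre_in_dball:
  assumes "quasi_pseudometric_on X d" "x \<in> X" "e > 0"
  shows "x \<in> dball X d x e"
  using assms quasi_pseudometric_onD(3)[OF assms(1)] by (simp add: dball_def)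

text \<open>
  A single radius serves for the finitely many restricted coordinates, so a neighbourhood in the
  product is described by a finite set of indices and one positive number.
\<close>

lemma openin_product_dtopology:
  assumes spaces: "\<forall>i\<in>I. quasi_pseudometric_on (X i) (d i)"
  shows "openin (product_topology (\<lambda>i. dtopology (X i) (d i)) I) U \<longleftrightarrow>
    U \<subseteq> Pi\<^sub>E I X \<and>
    (\<forall>x\<in>U. \<exists>J \<delta>. finite J \<and> J \<subseteq> I \<and> \<delta> > 0 \<and>
       (\<forall>y\<in>Pi\<^sub>E I X. (\<forall>i\<in>J. d i (x i) (y i) < \<delta>) \<longrightarrow> y \<in> U))"
    (is "?L \<longleftrightarrow> ?R")
proof -
  have qp: "quasi_pseudometric_on (X i) (d i)" if "i \<in> I" for i
    using spaces that by blast
  have top: "topspace (dtopology (X i) (d i)) = X i" if "i \<in> I" for i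
    using topspace_dtopology[OF qp[OF that]] .
  show ?thesis
  proof
    assume L: ?L
    have sub: "U \<subseteq> Pi\<^sub>E I X"
    proof -
      have "U \<subseteq> (\<Pi>\<^sub>E i\<in>I. topspace (dtopology (X i) (d i)))"
        using openin_subset[OF L] by simp
      also have "\<dots> = Pi\<^sub>E I X"
        using top by (rule PiE_cong)
      finally show ?thesis .
    qed
    show ?R
    proof (intro conjI ballI)
      show "U \<subseteq> Pi\<^sub>E I X" by (rule sub)
      fix x assume x: "x \<in> U"
      obtain W where fin: "finite {i \<in> I. W i \<noteq> topspace (dtopology (X i) (d i))}"
        and W: "\<forall>i\<in>I. openin (dtopology (X i) (d i)) (W i)"
        and xW: "x \<in> Pi\<^sub>E I W" and WU: "Pi\<^sub>E I W \<subseteq> U"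
        using L x unfolding openin_product_topology_alt by blast
      define J where "J = {i \<in> I. W i \<noteq> topspace (dtopology (X i) (d i))}"
      have "\<forall>i\<in>I. \<exists>e>0. dball (X i) (d i) (x i) e \<subseteq> W i"
        using W xW openin_dtopology[OF qp] by (metis PiE_mem)
      then obtain e where e: "\<forall>i\<in>I. e i > 0 \<and> dball (X i) (d i) (x i) (e i) \<subseteq> W i"
        by metis
      define \<delta> where "\<delta> = Min (insert 1 (e ` J))"
      have J: "finite J" "J \<subseteq> I"
        using fin by (auto simp: J_def)
      have "\<delta> > 0"
        unfolding \<delta>_def using J e by (subst Min_gr_iff) auto
      moreover have "y \<in> U" if y: "y \<in> Pi\<^sub>E I X" "\<forall>i\<in>J. d i (x i) (y i) < \<delta>" for y
      proof -
        have "y i \<in> W i" if i: "i \<in> I" for i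
        proof (cases "i \<in> J")
          case True
          then have "\<delta> \<le> e i"
            unfolding \<delta>_def using J by (intro Min_le) auto
          then have "y i \<in> dball (X i) (d i) (x i) (e i)"
            using y True i by (force simp: dball_def)
          then show ?thesis using e i by blast
        next
          case False
          then show ?thesis
            using y i top[OF i] by (auto simp: J_def)
        qed
        then have "y \<in> Pi\<^sub>E I W"
          using y(1) by (simp add: PiE_iff)
        then show ?thesis using WU by blast
      qed
      ultimately show "\<exists>J \<delta>. finite J \<and> J \<subseteq> I \<and> \<delta> > 0 \<and>
         (\<forall>y\<in>Pi\<^sub>E I X. (\<forall>i\<in>J. d i (x i) (y i) < \<delta>) \<longrightarrow> y \<in> U)"
        using J by blast
    qed
  next
    assume R: ?R
    show ?L
      unfolding openin_product_topology_alt
    proof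
      fix x assume x: "x \<in> U"
      then have xX: "x \<in> Pi\<^sub>E I X" using R by blast
      obtain J \<delta> where J: "finite J" "J \<subseteq> I" and \<delta>: "\<delta> > 0"
        and U: "\<forall>y\<in>Pi\<^sub>E I X. (\<forall>i\<in>J. d i (x i) (y i) < \<delta>) \<longrightarrow> y \<in> U"
        using R x by blast
      define W where "W i = (if i \<in> J then dball (X i) (d i) (x i) \<delta> else X i)" for i
      have "{i \<in> I. W i \<noteq> topspace (dtopology (X i) (d i))} \<subseteq> J"
        using top by (auto simp: W_def)
      then have "finite {i \<in> I. W i \<noteq> topspace (dtopology (X i) (d i))}"
        using J(1) finite_subset by blast
      moreover have "openin (dtopology (X i) (d i)) (W i)" if i: "i \<in> I" for i
        using openin_dball[OF qp[OF i]] openin_topspace[of "dtopology (X i) (d i)"] top[OF i] xX i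
        by (auto simp: W_def)
      moreover have "x \<in> Pi\<^sub>E I W"
        using xX centre_in_dball[OF qp _ \<delta>] by (auto simp: W_def PiE_iff)
      moreover have "Pi\<^sub>E I W \<subseteq> U"
      proof
        fix y assume y: "y \<in> Pi\<^sub>E I W"
        have "y i \<in> X i" if "i \<in> I" for i
          using PiE_mem[OF y that] by (auto simp: W_def dball_def split: if_splits)
        moreover have "d i (x i) (y i) < \<delta>" if "i \<in> J" for i
          using PiE_mem[OF y] that J(2) by (force simp: W_def dball_def)
        moreover have "y \<in> extensional I" using y by (simp add: PiE_iff)
        ultimately show "y \<in> U" using U by (auto simp: PiE_iff)
      qed
      ultimately show "\<exists>W. finite {i \<in> I. W i \<noteq> topspace (dtopology (X i) (d i))} \<and>
          (\<forall>i\<in>I. openin (dtopology (X i) (d i)) (W i)) \<and> x \<in> Pi\<^sub>E I W \<and> Pi\<^sub>E I W \<subseteq> U"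
        by blast
    qed
  qed
qed

section \<open>Functions on nonnegative families\<close>

lemma zero_pow_in_nonneg_pow: "zero_pow I \<in> nonneg_pow I"
  by (simp add: zero_pow_def nonneg_pow_def)

lemma zero_preimage_eq_iff:
  "zero_preimage I F = {zero_pow I} \<longleftrightarrow>
     F (zero_pow I) = 0 \<and> (\<forall>a\<in>nonneg_pow I. F a = 0 \<longrightarrow> a = zero_pow I)"
  using zero_pow_in_nonneg_pow[of I] by (auto simp: zero_preimage_def)

lemma nonneg_pow_eq_zero_pow_iff:
  "a \<in> nonneg_pow I \<Longrightarrow> a = zero_pow I \<longleftrightarrow> (\<forall>i\<in>I. a i = 0)"
  by (auto simp: zero_pow_def nonneg_pow_def PiE_iff extensional_def fun_eq_iff)

lemma dprod_in_nonneg_pow: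
  assumes "\<And>i. i \<in> I \<Longrightarrow> quasi_pseudometric_on (X i) (d i)" "x \<in> Pi\<^sub>E I X" "y \<in> Pi\<^sub>E I X"
  shows "dprod I d x y \<in> nonneg_pow I"
  using quasi_pseudometric_onD(2)[OF assms(1)] PiE_mem[OF assms(2)] PiE_mem[OF assms(3)]
  by (simp add: dprod_def nonneg_pow_def)

lemma top_of_set_eq_dtopology: "top_of_set S = dtopology S dist"
  if "S \<noteq> {}" for S :: "'a::metric_space set"
proof -
  have qp: "quasi_pseudometric_on S (dist :: 'a \<Rightarrow> 'a \<Rightarrow> real)"
    using that by (auto simp: quasi_pseudometric_on_def intro: dist_triangle)
  show ?thesis
    unfolding topology_eq openin_dtopology[OF qp] openin_euclidean_subtopology_iff
    by (auto simp: dball_def dist_commute subset_iff) metis+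
qed

lemma continuous_at_zero_pow_iff:
  assumes F: "F \<in> nonneg_pow I \<rightarrow> {0..}" and F0: "F (zero_pow I) = 0"
  shows "continuous_at_zero_pow I F \<longleftrightarrow>
    (\<forall>e>0. \<exists>J \<delta>. finite J \<and> J \<subseteq> I \<and> \<delta> > 0 \<and>
       (\<forall>a\<in>nonneg_pow I. (\<forall>i\<in>J. a i < \<delta>) \<longrightarrow> F a < e))"
    (is "?L \<longleftrightarrow> ?R")
proof -
  let ?T = "product_topology (\<lambda>i. top_of_set {0::real..}) I"
  have qp: "\<forall>i\<in>I. quasi_pseudometric_on {0::real..} dist"
    by (auto simp: quasi_pseudometric_on_def intro: dist_triangle)
  have T: "?T = product_topology (\<lambda>i. dtopology {0::real..} dist) I"
    by (simp add: top_of_set_eq_dtopology)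
  have top: "topspace ?T = nonneg_pow I"
    by (simp add: nonneg_pow_def)
  have d0: "dist (zero_pow I i) (a i) = a i" if "a \<in> nonneg_pow I" "i \<in> I" for a i
    using that by (auto simp: zero_pow_def nonneg_pow_def dist_real_def PiE_iff)
  show ?thesis
  proof
    assume L: ?L
    show ?R
    proof (intro allI impI)
      fix e :: real assume "e > 0"
      moreover have "openin (top_of_set {0..}) {0..<e}"
        unfolding openin_open by (rule exI[of _ "{..<e}"]) auto
      ultimately obtain U where U: "openin ?T U" "zero_pow I \<in> U" "\<forall>a\<in>U. F a \<in> {0..<e}"
        using L F0 unfolding continuous_at_zero_pow_def topcontinuous_at_def
        by (metis atLeastLessThan_iff order_refl)
      obtain J \<delta> where J: "finite J" "J \<subseteq> I" "\<delta> > 0"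
        and sub: "\<forall>a\<in>nonneg_pow I. (\<forall>i\<in>J. dist (zero_pow I i) (a i) < \<delta>) \<longrightarrow> a \<in> U"
        using U(1,2) unfolding T openin_product_dtopology[OF qp] nonneg_pow_def by blast
      have "F a < e" if "a \<in> nonneg_pow I" "\<forall>i\<in>J. a i < \<delta>" for a
      proof -
        have "a \<in> U" using sub that d0 J(2) by (simp add: subset_iff)
        then show ?thesis using U(3) by simp
      qed
      then show "\<exists>J \<delta>. finite J \<and> J \<subseteq> I \<and> \<delta> > 0 \<and>
          (\<forall>a\<in>nonneg_pow I. (\<forall>i\<in>J. a i < \<delta>) \<longrightarrow> F a < e)"
        using J by blast
    qed
  next
    assume R: ?R
    show ?L
      unfolding continuous_at_zero_pow_def topcontinuous_at_def top
    proof (intro conjI allI impI)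
      show "zero_pow I \<in> nonneg_pow I" by (rule zero_pow_in_nonneg_pow)
      show "F \<in> nonneg_pow I \<rightarrow> topspace (top_of_set {0..})"
        using F by simp
      fix V assume V: "openin (top_of_set {0..}) V \<and> F (zero_pow I) \<in> V"
      then obtain e where e: "e > 0" "\<forall>t\<in>{0..}. dist t 0 < e \<longrightarrow> t \<in> V"
        unfolding openin_euclidean_subtopology_iff F0 by blast
      obtain J \<delta> where J: "finite J" "J \<subseteq> I" "\<delta> > 0"
        and small: "\<forall>a\<in>nonneg_pow I. (\<forall>i\<in>J. a i < \<delta>) \<longrightarrow> F a < e"
        using R e(1) by meson
      define U where "U = (\<Pi>\<^sub>E i\<in>I. if i \<in> J then {0..<\<delta>} else {0..})"
      have "openin (top_of_set {0..}) {0..<\<delta>}"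
        unfolding openin_open by (rule exI[of _ "{..<\<delta>}"]) auto
      then have "\<forall>i\<in>I. openin (top_of_set {0..}) (if i \<in> J then {0..<\<delta>} else {0..})"
        by simp
      moreover have "finite {i \<in> I. (if i \<in> J then {0..<\<delta>} else {0..}) \<noteq>
          topspace (top_of_set {0..})}"
        by (rule finite_subset[OF _ J(1)]) auto
      ultimately have "openin ?T U"
        unfolding U_def openin_PiE_gen by blast
      moreover have "zero_pow I \<in> U"
        using J by (auto simp: U_def zero_pow_def)
      moreover have "F a \<in> V" if a: "a \<in> U" for a
      proof -
        have "0 \<le> a i \<and> (i \<in> J \<longrightarrow> a i < \<delta>)" if "i \<in> I" for i
          using PiE_mem[OF a[unfolded U_def] that] by (simp split: if_splits)
        then have "a \<in> nonneg_pow I" "\<forall>i\<in>J. a i < \<delta>"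
          using J(2) a by (auto simp: nonneg_pow_def U_def PiE_iff)
        then have "F a < e" "F a \<ge> 0" using small F by auto
        then show ?thesis using e(2) by simp
      qed
      ultimately show "\<exists>U. openin ?T U \<and> zero_pow I \<in> U \<and> (\<forall>a\<in>U. F a \<in> V)"
        by blast
    qed
  qed
qed

text \<open>
  A function that preserves triangle triplets need not be monotone, but it is so up to the factor
  2. This substitute serves in both directions of the proof.
\<close>

lemma preserves_triangle_triplets_doubling:
  assumes "preserves_triangle_triplets I F" "a \<in> nonneg_pow I" "b \<in> nonneg_pow I"
    and "\<And>i. i \<in> I \<Longrightarrow> a i \<le> 2 * b i"
  shows "F a \<le> 2 * F b"
proof -
  have "triangle_triplet_pow I a b b"
    using assms(2-4) by (fastforce simp: triangle_triplet_pow_def triangle_triplet_def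
      nonneg_pow_def PiE_iff)
  then have "triangle_triplet (F a) (F b) (F b)"
    using assms(1-3) unfolding preserves_triangle_triplets_def by blast
  then show ?thesis by (simp add: triangle_triplet_def)
qed

lemma subadditive_monotone_sum_bound:
  assumes "subadditive_pow I F" "monotone_pow I F"
    and abc: "a \<in> nonneg_pow I" "b \<in> nonneg_pow I" "c \<in> nonneg_pow I"
    and le: "\<And>i. i \<in> I \<Longrightarrow> a i \<le> b i + c i"
  shows "F a \<le> F b + F c"
proof -
  let ?s = "\<lambda>i\<in>I. b i + c i"
  have s: "?s \<in> nonneg_pow I"
    using abc by (auto simp: nonneg_pow_def PiE_iff)
  have "F a \<le> F ?s"
    using assms(2) abc(1) s le unfolding monotone_pow_def monotone_on_def by simp
  also have "\<dots> \<le> F b + F c"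
    using assms(1) abc unfolding subadditive_pow_def by blast
  finally show ?thesis .
qed

lemma subadditive_monotone_imp_preserves_triangle_triplets:
  assumes "subadditive_pow I F" "monotone_pow I F"
  shows "preserves_triangle_triplets I F"
  unfolding preserves_triangle_triplets_def triangle_triplet_pow_def triangle_triplet_def
  by (intro ballI impI conjI subadditive_monotone_sum_bound[OF assms]) auto

section \<open>Sufficiency of the algebraic conditions\<close>

text \<open>
  This makes the topology of the aggregated distance at least as fine as the product topology.
  The comparison is with the family whose only nonzero entry is \<open>\<epsilon>\<close>, at the index \<open>i\<close>. It is at
  most any family \<open>a\<close> with \<open>a i \<ge> \<epsilon>\<close>, and the value of \<open>F\<close> there is positive.
\<close>

lemma small_value_imp_small_coordinate:
  assumes F: "F \<in> nonneg_pow I \<rightarrow> {0..}" and Z: "zero_preimage I F = {zero_pow I}"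
    and P: "preserves_triangle_triplets I F" and i: "i \<in> I" and \<epsilon>: "\<epsilon> > 0"
  shows "\<exists>\<delta>>0. \<forall>a\<in>nonneg_pow I. F a < \<delta> \<longrightarrow> a i < \<epsilon>"
proof -
  define u where "u = (\<lambda>j\<in>I. if j = i then \<epsilon> else 0)"
  have u: "u \<in> nonneg_pow I"
    using \<epsilon> by (auto simp: u_def nonneg_pow_def)
  have "u \<noteq> zero_pow I"
    using nonneg_pow_eq_zero_pow_iff[OF u] i \<epsilon> by (auto simp: u_def)
  then have "F u \<noteq> 0" using Z u unfolding zero_preimage_eq_iff by blast
  then have pos: "F u / 2 > 0" using F u by force
  have "a i < \<epsilon>" if a: "a \<in> nonneg_pow I" "F a < F u / 2" for a
  proof (rule ccontr)
    assume "\<not> a i < \<epsilon>"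
    then have "u j \<le> 2 * a j" if "j \<in> I" for j
      using that a(1) \<epsilon> by (auto simp: u_def nonneg_pow_def PiE_iff)
    from preserves_triangle_triplets_doubling[OF P u a(1) this] a(2)
    show False by simp
  qed
  with pos show ?thesis by blast
qed

lemma product_topology_eq_dtopology:
  assumes F: "F \<in> nonneg_pow I \<rightarrow> {0..}" and Z: "zero_preimage I F = {zero_pow I}"
    and C: "continuous_at_zero_pow I F" and P: "preserves_triangle_triplets I F"
    and qp: "\<And>i. i \<in> I \<Longrightarrow> quasi_pseudometric_on (X i) (d i)"
    and qpF: "quasi_pseudometric_on (Pi\<^sub>E I X) (\<lambda>x y. F (dprod I d x y))"
  shows "product_topology (\<lambda>i. dtopology (X i) (d i)) I =
    dtopology (Pi\<^sub>E I X) (\<lambda>x y. F (dprod I d x y))"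
proof -
  note cont = C[unfolded continuous_at_zero_pow_iff[OF F conjunct1[OF Z[unfolded zero_preimage_eq_iff]]],
    rule_format]
  have same_neighbourhoods: "(\<exists>J \<delta>. finite J \<and> J \<subseteq> I \<and> \<delta> > 0 \<and>
       (\<forall>y\<in>Pi\<^sub>E I X. (\<forall>i\<in>J. d i (x i) (y i) < \<delta>) \<longrightarrow> y \<in> U)) \<longleftrightarrow>
     (\<exists>e>0. dball (Pi\<^sub>E I X) (\<lambda>x y. F (dprod I d x y)) x e \<subseteq> U)" (is "?N \<longleftrightarrow> ?B")
    if x: "x \<in> Pi\<^sub>E I X" for x U
  proof
    assume ?N
    then obtain J \<delta> where J: "finite J" "J \<subseteq> I" "\<delta> > 0"
      and U: "\<forall>y\<in>Pi\<^sub>E I X. (\<forall>i\<in>J. d i (x i) (y i) < \<delta>) \<longrightarrow> y \<in> U" by blast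
    have "\<forall>i\<in>J. \<exists>\<eta>>0. \<forall>a\<in>nonneg_pow I. F a < \<eta> \<longrightarrow> a i < \<delta>"
      using small_value_imp_small_coordinate[OF F Z P _ J(3)] J(2) by blast
    then obtain \<eta> where \<eta>: "\<forall>i\<in>J. \<eta> i > 0 \<and> (\<forall>a\<in>nonneg_pow I. F a < \<eta> i \<longrightarrow> a i < \<delta>)"
      by metis
    define e where "e = Min (insert 1 (\<eta> ` J))"
    have "e > 0"
      unfolding e_def using J(1) \<eta> by (subst Min_gr_iff) auto
    moreover have "y \<in> U" if y: "y \<in> Pi\<^sub>E I X" "F (dprod I d x y) < e" for y
    proof -
      have "d i (x i) (y i) < \<delta>" if i: "i \<in> J" for i
      proof -
        have "e \<le> \<eta> i"
          unfolding e_def using J(1) i by (intro Min_le) auto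
        then have "dprod I d x y i < \<delta>"
          using \<eta> i y(2) dprod_in_nonneg_pow[OF qp x y(1)] by force
        then show ?thesis using i J(2) by (auto simp: dprod_def)
      qed
      then show ?thesis using U y(1) by blast
    qed
    ultimately show ?B by (auto simp: dball_def)
  next
    assume ?B
    then obtain e where e: "e > 0" "dball (Pi\<^sub>E I X) (\<lambda>x y. F (dprod I d x y)) x e \<subseteq> U"
      by blast
    obtain J \<delta> where J: "finite J" "J \<subseteq> I" "\<delta> > 0"
      and small: "\<forall>a\<in>nonneg_pow I. (\<forall>i\<in>J. a i < \<delta>) \<longrightarrow> F a < e"
      using cont[OF e(1)] by blast
    have "y \<in> U" if y: "y \<in> Pi\<^sub>E I X" "\<forall>i\<in>J. d i (x i) (y i) < \<delta>" for y
    proof -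
      have "\<forall>i\<in>J. dprod I d x y i < \<delta>"
        using y(2) J(2) by (auto simp: dprod_def)
      then have "F (dprod I d x y) < e"
        using small dprod_in_nonneg_pow[OF qp x y(1)] by blast
      then show ?thesis using e(2) y(1) by (auto simp: dball_def)
    qed
    then show ?N using J by blast
  qed
  have spaces: "\<forall>i\<in>I. quasi_pseudometric_on (X i) (d i)"
    using qp by blast
  show ?thesis
    unfolding topology_eq openin_product_dtopology[OF spaces] openin_dtopology[OF qpF]
    by (intro allI conj_cong refl ball_cong) (rule same_neighbourhoods, blast)
qed

text \<open>
  The hypothesis \<open>sum\<close> stays open here because it is met in two ways: by preservation of triangle
  triplets when the distances are symmetric, by subadditivity and monotonicity in general.
\<close>

lemma quasi_pseudometric_on_dprod:
  assumes F: "F \<in> nonneg_pow I \<rightarrow> {0..}" and F0: "F (zero_pow I) = 0"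
    and qp: "\<And>i. i \<in> I \<Longrightarrow> quasi_pseudometric_on (X i) (d i)"
    and sum: "\<And>x y z. \<lbrakk>x \<in> Pi\<^sub>E I X; y \<in> Pi\<^sub>E I X; z \<in> Pi\<^sub>E I X\<rbrakk> \<Longrightarrow>
      F (dprod I d x z) \<le> F (dprod I d x y) + F (dprod I d y z)"
  shows "quasi_pseudometric_on (Pi\<^sub>E I X) (\<lambda>x y. F (dprod I d x y))"
  unfolding quasi_pseudometric_on_def
proof (intro conjI ballI sum)
  show "Pi\<^sub>E I X \<noteq> {}"
    using quasi_pseudometric_onD(1)[OF qp] by (simp add: PiE_eq_empty_iff)
  fix x assume x: "x \<in> Pi\<^sub>E I X"
  show "0 \<le> F (dprod I d x y)" if "y \<in> Pi\<^sub>E I X" for y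
    using F dprod_in_nonneg_pow[OF qp x that] by auto
  have "dprod I d x x = zero_pow I"
    unfolding dprod_def zero_pow_def
    using quasi_pseudometric_onD(3)[OF qp] x by (intro restrict_ext) (auto simp: PiE_iff)
  then show "F (dprod I d x x) = 0" using F0 by simp
qed

lemma zero_preimage_dprod_separates:
  assumes Z: "zero_preimage I F = {zero_pow I}"
    and q: "\<And>i. i \<in> I \<Longrightarrow> quasi_metric_on (X i) (d i)"
    and xy: "x \<in> Pi\<^sub>E I X" "y \<in> Pi\<^sub>E I X"
    and 0: "F (dprod I d x y) = 0" "F (dprod I d y x) = 0"
  shows "x = y"
proof (rule PiE_ext[OF xy])
  have qp: "quasi_pseudometric_on (X i) (d i)" if "i \<in> I" for i
    using q[OF that] by (simp add: quasi_metric_on_def)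
  note mem = dprod_in_nonneg_pow[OF qp xy] dprod_in_nonneg_pow[OF qp xy(2,1)]
  fix i assume i: "i \<in> I"
  have "dprod I d x y i = 0" "dprod I d y x i = 0"
    using Z mem 0 i nonneg_pow_eq_zero_pow_iff unfolding zero_preimage_eq_iff by metis+
  then have "d i (x i) (y i) = 0" "d i (y i) (x i) = 0"
    using i by (simp_all add: dprod_def)
  then show "x i = y i"
    using q[OF i] xy i unfolding quasi_metric_on_def by (meson PiE_mem)
qed

lemma dprod_commute:
  assumes "\<And>i. i \<in> I \<Longrightarrow> \<forall>u\<in>X i. \<forall>v\<in>X i. d i u v = d i v u" "x \<in> Pi\<^sub>E I X" "y \<in> Pi\<^sub>E I X"
  shows "dprod I d x y = dprod I d y x"
  unfolding dprod_def using assms by (intro restrict_ext) (meson PiE_mem)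

lemma is_space_dprod:
  assumes Z: "zero_preimage I F = {zero_pow I}"
    and sp: "\<And>i. i \<in> I \<Longrightarrow> is_space K (X i) (d i)"
    and qpF: "quasi_pseudometric_on (Pi\<^sub>E I X) (\<lambda>x y. F (dprod I d x y))"
  shows "is_space K (Pi\<^sub>E I X) (\<lambda>x y. F (dprod I d x y))"
proof -
  have sym: "\<forall>x\<in>Pi\<^sub>E I X. \<forall>y\<in>Pi\<^sub>E I X. F (dprod I d x y) = F (dprod I d y x)"
    if "K = Metric \<or> K = Pseudometric"
  proof (intro ballI)
    fix x y assume xy: "x \<in> Pi\<^sub>E I X" "y \<in> Pi\<^sub>E I X"
    have "\<forall>u\<in>X i. \<forall>v\<in>X i. d i u v = d i v u" if "i \<in> I" for i
      using sp[OF that] \<open>K = Metric \<or> K = Pseudometric\<close>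
      by (auto simp: metric_on_def pseudometric_on_def)
    from dprod_commute[OF this xy]
    show "F (dprod I d x y) = F (dprod I d y x)" by simp
  qed
  have sep: "\<forall>x\<in>Pi\<^sub>E I X. \<forall>y\<in>Pi\<^sub>E I X.
      F (dprod I d x y) = 0 \<and> F (dprod I d y x) = 0 \<longrightarrow> x = y"
    if "K = Metric \<or> K = Quasi_Metric"
  proof (intro ballI impI)
    fix x y assume xy: "x \<in> Pi\<^sub>E I X" "y \<in> Pi\<^sub>E I X"
      and 0: "F (dprod I d x y) = 0 \<and> F (dprod I d y x) = 0"
    have "quasi_metric_on (X i) (d i)" if "i \<in> I" for i
      using sp[OF that] \<open>K = Metric \<or> K = Quasi_Metric\<close> by (auto simp: metric_on_def)
    from zero_preimage_dprod_separates[OF Z this xy] 0 show "x = y" by blast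
  qed
  show ?thesis
    using sym sep qpF
    by (cases K) (simp_all add: metric_on_def quasi_metric_on_def pseudometric_on_def)
qed

lemma strongly_aggregationI:
  fixes F :: "('i \<Rightarrow> real) \<Rightarrow> real"
  assumes F: "F \<in> nonneg_pow I \<rightarrow> {0..}" and Z: "zero_preimage I F = {zero_pow I}"
    and C: "continuous_at_zero_pow I F" and P: "preserves_triangle_triplets I F"
    and sum: "\<And>(X :: 'i \<Rightarrow> 'a set) d x y z.
      \<lbrakk>\<And>i. i \<in> I \<Longrightarrow> is_space K (X i) (d i); x \<in> Pi\<^sub>E I X; y \<in> Pi\<^sub>E I X; z \<in> Pi\<^sub>E I X\<rbrakk> \<Longrightarrow>
      F (dprod I d x z) \<le> F (dprod I d x y) + F (dprod I d y z)"
  shows "strongly_aggregation_on_products TYPE('a) K I F"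
proof -
  have F0: "F (zero_pow I) = 0" using Z by (simp add: zero_preimage_eq_iff)
  have "is_space K (Pi\<^sub>E I X) (\<lambda>x y. F (dprod I d x y)) \<and>
      product_topology (\<lambda>i. dtopology (X i) (d i)) I =
      dtopology (Pi\<^sub>E I X) (\<lambda>x y. F (dprod I d x y))"
    if "\<forall>i\<in>I. is_space K (X i) (d i)" for X :: "'i \<Rightarrow> 'a set" and d
  proof -
    have sp: "\<And>i. i \<in> I \<Longrightarrow> is_space K (X i) (d i)" using that by blast
    have qp: "\<And>i. i \<in> I \<Longrightarrow> quasi_pseudometric_on (X i) (d i)"
      using sp is_space_imp_quasi_pseudometric_on by blast
    have qpF: "quasi_pseudometric_on (Pi\<^sub>E I X) (\<lambda>x y. F (dprod I d x y))"
      by (rule quasi_pseudometric_on_dprod[OF F F0 qp sum[OF sp]])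
    show ?thesis
      using is_space_dprod[OF Z sp qpF] product_topology_eq_dtopology[OF F Z C P qp qpF] by blast
  qed
  then show ?thesis
    unfolding strongly_aggregation_on_products_def aggregation_on_products_def by blast
qed

lemma strongly_aggregation_if_subadditive_monotone:
  fixes F :: "('i \<Rightarrow> real) \<Rightarrow> real"
  assumes F: "F \<in> nonneg_pow I \<rightarrow> {0..}" and Z: "zero_preimage I F = {zero_pow I}"
    and S: "subadditive_pow I F" "monotone_pow I F" and C: "continuous_at_zero_pow I F"
  shows "strongly_aggregation_on_products TYPE('a) K I F"
proof (rule strongly_aggregationI
    [OF F Z C subadditive_monotone_imp_preserves_triangle_triplets[OF S]])
  fix X :: "'i \<Rightarrow> 'a set" and d x y z
  assume sp: "\<And>i. i \<in> I \<Longrightarrow> is_space K (X i) (d i)"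
    and xyz: "x \<in> Pi\<^sub>E I X" "y \<in> Pi\<^sub>E I X" "z \<in> Pi\<^sub>E I X"
  note qp = is_space_imp_quasi_pseudometric_on[OF sp]
  have mem: "dprod I d u v \<in> nonneg_pow I" if "u \<in> Pi\<^sub>E I X" "v \<in> Pi\<^sub>E I X" for u v
    using dprod_in_nonneg_pow[of I X d u v] qp that by blast
  show "F (dprod I d x z) \<le> F (dprod I d x y) + F (dprod I d y z)"
  proof (rule subadditive_monotone_sum_bound[OF S])
    show "dprod I d x z i \<le> dprod I d x y i + dprod I d y z i" if "i \<in> I" for i
      using quasi_pseudometric_onD(4)[OF qp[OF that]] xyz that by (simp add: dprod_def PiE_mem)
  qed (use mem xyz in auto)
qed

lemma strongly_aggregation_if_preserves_triangle_triplets: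
  fixes F :: "('i \<Rightarrow> real) \<Rightarrow> real"
  assumes F: "F \<in> nonneg_pow I \<rightarrow> {0..}" and Z: "zero_preimage I F = {zero_pow I}"
    and C: "continuous_at_zero_pow I F" and P: "preserves_triangle_triplets I F"
    and K: "K \<in> {Metric, Pseudometric}"
  shows "strongly_aggregation_on_products TYPE('a) K I F"
proof (rule strongly_aggregationI[OF F Z C P])
  fix X :: "'i \<Rightarrow> 'a set" and d x y z
  assume sp: "\<And>i. i \<in> I \<Longrightarrow> is_space K (X i) (d i)"
    and xyz: "x \<in> Pi\<^sub>E I X" "y \<in> Pi\<^sub>E I X" "z \<in> Pi\<^sub>E I X"
  note qp = is_space_imp_quasi_pseudometric_on[OF sp]
  have mem: "dprod I d u v \<in> nonneg_pow I" if "u \<in> Pi\<^sub>E I X" "v \<in> Pi\<^sub>E I X" for u v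
    using dprod_in_nonneg_pow[of I X d u v] qp that by blast
  have "triangle_triplet_pow I (dprod I d x z) (dprod I d x y) (dprod I d y z)"
    unfolding triangle_triplet_pow_def
  proof
    fix i assume i: "i \<in> I"
    have m: "x i \<in> X i" "y i \<in> X i" "z i \<in> X i" using xyz i by auto
    have sym: "d i u v = d i v u" if "u \<in> X i" "v \<in> X i" for u v
      using sp[OF i] K that by (auto simp: metric_on_def pseudometric_on_def)
    note tri = quasi_pseudometric_onD(4)[OF qp[OF i]]
    show "triangle_triplet (dprod I d x z i) (dprod I d x y i) (dprod I d y z i)"
      using i tri[OF m] tri[OF m(1,3,2)] tri[OF m(2,1,3)] sym[OF m(3,2)] sym[OF m(2,1)]
      by (simp add: triangle_triplet_def dprod_def)
  qed
  then have "triangle_triplet (F (dprod I d x z)) (F (dprod I d x y)) (F (dprod I d y z))"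
    using P mem xyz unfolding preserves_triangle_triplets_def by blast
  then show "F (dprod I d x z) \<le> F (dprod I d x y) + F (dprod I d y z)"
    by (simp add: triangle_triplet_def)
qed

section \<open>Spaces with three points\<close>

lemma infinite_obtain_three:
  assumes "infinite (UNIV :: 'a set)"
  obtains p q r :: 'a where "p \<noteq> q" "p \<noteq> r" "q \<noteq> r"
proof -
  obtain f :: "nat \<Rightarrow> 'a" where "inj f"
    using infinite_countable_subset[OF assms] by blast
  then show ?thesis
    by (intro that[of "f 0" "f 1" "f 2"]) (simp_all add: inj_eq)
qed

text \<open>
  When one of the three lengths vanishes, the other two are equal and two of the three points must
  coincide for the distance to be a metric; a space with two points, or one, is then used.
\<close>

lemma metric_space_of_triangle_triplet:
  assumes inf: "infinite (UNIV :: 'a set)"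
    and nn: "0 \<le> a" "0 \<le> b" "0 \<le> c" and t: "triangle_triplet a b c"
  shows "\<exists>(X :: 'a set) d x y z. metric_on X d \<and> x \<in> X \<and> y \<in> X \<and> z \<in> X \<and>
    d x z = a \<and> d x y = b \<and> d y z = c"
proof -
  obtain p q r :: 'a where pqr: "p \<noteq> q" "p \<noteq> r" "q \<noteq> r"
    using infinite_obtain_three[OF inf] .
  note defs = metric_on_def quasi_metric_on_def quasi_pseudometric_on_def
  have two: "\<exists>(X :: 'a set) d x y. metric_on X d \<and> x \<in> X \<and> y \<in> X \<and> d x y = s \<and> d y x = s \<and>
      d x x = 0 \<and> d y y = 0" if "s \<ge> 0" for s :: real
  proof (cases "s = 0")
    case True
    then show ?thesis
      by (intro exI[of _ "{p}"] exI[of _ "\<lambda>_ _. 0"] exI[of _ p]) (simp add: defs)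
  next
    case False
    with that pqr show ?thesis
      by (intro exI[of _ "{p, q}"] exI[of _ "\<lambda>u v. if u = v then 0 else s"] exI[of _ p]
          exI[of _ q]) (auto simp: defs)
  qed
  consider "a = 0" | "b = 0" | "c = 0" | "a > 0" "b > 0" "c > 0"
    using nn by linarith
  then show ?thesis
  proof cases
    case 1
    with t nn have "b = c" by (simp add: triangle_triplet_def)
    with 1 two[OF nn(2)] show ?thesis by metis
  next
    case 2
    with t nn have "a = c" by (simp add: triangle_triplet_def)
    with 2 two[OF nn(1)] show ?thesis by metis
  next
    case 3
    with t nn have "a = b" by (simp add: triangle_triplet_def)
    with 3 two[OF nn(1)] show ?thesis by metis
  next
    case 4
    define d where "d u v = (if u = v then 0 else if {u, v} = {p, r} then a
      else if {u, v} = {p, q} then b else c)" for u v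
    have d: "d p p = 0" "d q q = 0" "d r r = 0" "d p r = a" "d r p = a" "d p q = b" "d q p = b"
      "d q r = c" "d r q = c"
      using pqr by (auto simp: d_def doubleton_eq_iff)
    have "metric_on {p, q, r} d"
      using 4 t unfolding defs triangle_triplet_def by (simp add: d)
    then show ?thesis
      using d by (intro exI[of _ "{p, q, r}"] exI[of _ d] exI[of _ p] exI[of _ q] exI[of _ r]) simp
  qed
qed

text \<open>
  Giving the three backward distances the value \<open>a + b + c + 1\<close> makes every other triangle
  inequality hold trivially, and its positivity separates the points even where \<open>a\<close>, \<open>b\<close> or \<open>c\<close>
  vanishes.
\<close>

lemma quasi_metric_space_of_sum_bound:
  assumes inf: "infinite (UNIV :: 'a set)"
    and nn: "0 \<le> a" "0 \<le> b" "0 \<le> c" and le: "a \<le> b + c"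
  shows "\<exists>(X :: 'a set) d x y z. quasi_metric_on X d \<and> x \<in> X \<and> y \<in> X \<and> z \<in> X \<and>
    d x z = a \<and> d x y = b \<and> d y z = c"
proof -
  obtain p q r :: 'a where pqr: "p \<noteq> q" "p \<noteq> r" "q \<noteq> r"
    using infinite_obtain_three[OF inf] .
  define M where "M = a + b + c + 1"
  define d where "d u v = (if u = v then 0 else if u = p \<and> v = r then a
      else if u = p \<and> v = q then b else if u = q \<and> v = r then c else M)" for u v
  have d: "d p p = 0" "d q q = 0" "d r r = 0" "d p r = a" "d r p = M" "d p q = b" "d q p = M"
    "d q r = c" "d r q = M"
    using pqr by (auto simp: d_def)
  have "quasi_metric_on {p, q, r} d"
    using nn le unfolding quasi_metric_on_def quasi_pseudometric_on_def by (simp add: d M_def)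
  then show ?thesis
    using d by (intro exI[of _ "{p, q, r}"] exI[of _ d] exI[of _ p] exI[of _ q] exI[of _ r]) simp
qed

section \<open>Necessity of the algebraic conditions\<close>

lemma aggregation_triangle_inequality:
  fixes F :: "('i \<Rightarrow> real) \<Rightarrow> real"
  assumes A: "aggregation_on_products TYPE('a) K I F"
    and abc: "a \<in> nonneg_pow I" "b \<in> nonneg_pow I" "c \<in> nonneg_pow I"
    and real: "\<And>i. i \<in> I \<Longrightarrow> \<exists>(X :: 'a set) d x y z. is_space K X d \<and>
      x \<in> X \<and> y \<in> X \<and> z \<in> X \<and> d x z = a i \<and> d x y = b i \<and> d y z = c i"
  shows "F a \<le> F b + F c"
proof -
  have "\<forall>i\<in>I. \<exists>(X :: 'a set) d x y z. is_space K X d \<and>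
      x \<in> X \<and> y \<in> X \<and> z \<in> X \<and> d x z = a i \<and> d x y = b i \<and> d y z = c i"
    using real by blast
  then obtain X :: "'i \<Rightarrow> 'a set" and d x y z where
    h: "\<forall>i\<in>I. is_space K (X i) (d i) \<and> x i \<in> X i \<and> y i \<in> X i \<and> z i \<in> X i \<and>
      d i (x i) (z i) = a i \<and> d i (x i) (y i) = b i \<and> d i (y i) (z i) = c i"
    by metis
  have eq: "dprod I d (restrict x I) (restrict z I) = a"
    "dprod I d (restrict x I) (restrict y I) = b" "dprod I d (restrict y I) (restrict z I) = c"
    using h abc by (auto simp: dprod_def nonneg_pow_def PiE_iff extensional_def fun_eq_iff)
  have "is_space K (Pi\<^sub>E I X) (\<lambda>x y. F (dprod I d x y))"
    using A h unfolding aggregation_on_products_def by blast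
  from quasi_pseudometric_onD(4)[OF is_space_imp_quasi_pseudometric_on[OF this],
      of "restrict x I" "restrict y I" "restrict z I"]
  show ?thesis using h by (simp add: eq)
qed

lemma aggregation_imp_preserves_triangle_triplets:
  fixes F :: "('i \<Rightarrow> real) \<Rightarrow> real"
  assumes A: "aggregation_on_products TYPE('a) K I F" and inf: "infinite (UNIV :: 'a set)"
  shows "preserves_triangle_triplets I F"
proof -
  have *: "F a \<le> F b + F c"
    if abc: "a \<in> nonneg_pow I" "b \<in> nonneg_pow I" "c \<in> nonneg_pow I"
      and t: "triangle_triplet_pow I a b c" for a b c
  proof (rule aggregation_triangle_inequality[OF A abc])
    fix i assume i: "i \<in> I"
    have "0 \<le> a i" "0 \<le> b i" "0 \<le> c i" "triangle_triplet (a i) (b i) (c i)"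
      using abc t i by (auto simp: nonneg_pow_def triangle_triplet_pow_def PiE_iff)
    from metric_space_of_triangle_triplet[OF inf this]
    show "\<exists>(X :: 'a set) d x y z. is_space K X d \<and> x \<in> X \<and> y \<in> X \<and> z \<in> X \<and>
        d x z = a i \<and> d x y = b i \<and> d y z = c i"
      using metric_on_imp_is_space by metis
  qed
  have perm: "triangle_triplet_pow I b a c" "triangle_triplet_pow I c a b"
    if "triangle_triplet_pow I a b c" for a b c
    using that by (auto simp: triangle_triplet_pow_def triangle_triplet_def add.commute)
  show ?thesis
    unfolding preserves_triangle_triplets_def triangle_triplet_def using * perm by blast
qed

lemma quasi_aggregation_sum_bound:
  fixes F :: "('i \<Rightarrow> real) \<Rightarrow> real"
  assumes A: "aggregation_on_products TYPE('a) K I F" and inf: "infinite (UNIV :: 'a set)"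
    and K: "K \<in> {Quasi_Metric, Quasi_Pseudometric}"
    and abc: "a \<in> nonneg_pow I" "b \<in> nonneg_pow I" "c \<in> nonneg_pow I"
    and le: "\<And>i. i \<in> I \<Longrightarrow> a i \<le> b i + c i"
  shows "F a \<le> F b + F c"
proof (rule aggregation_triangle_inequality[OF A abc])
  fix i assume i: "i \<in> I"
  have "0 \<le> a i" "0 \<le> b i" "0 \<le> c i"
    using abc i by (auto simp: nonneg_pow_def PiE_iff)
  from quasi_metric_space_of_sum_bound[OF inf this le[OF i]]
  show "\<exists>(X :: 'a set) d x y z. is_space K X d \<and> x \<in> X \<and> y \<in> X \<and> z \<in> X \<and>
      d x z = a i \<and> d x y = b i \<and> d y z = c i"
    using quasi_metric_on_imp_is_space[OF _ K] by metis
qed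

lemma quasi_aggregation_imp_subadditive_monotone:
  fixes F :: "('i \<Rightarrow> real) \<Rightarrow> real"
  assumes A: "aggregation_on_products TYPE('a) K I F" and inf: "infinite (UNIV :: 'a set)"
    and K: "K \<in> {Quasi_Metric, Quasi_Pseudometric}" and F0: "F (zero_pow I) = 0"
  shows "subadditive_pow I F" "monotone_pow I F"
proof -
  note bound = quasi_aggregation_sum_bound[OF A inf K]
  show "subadditive_pow I F"
    unfolding subadditive_pow_def
    by (intro ballI bound) (auto simp: nonneg_pow_def PiE_iff)
  have "F a \<le> F b" if "a \<in> nonneg_pow I" "b \<in> nonneg_pow I" "\<forall>i\<in>I. a i \<le> b i" for a b
    using bound[OF that(1,2) zero_pow_in_nonneg_pow] that(3) F0 by (simp add: zero_pow_def)
  then show "monotone_pow I F"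
    unfolding monotone_pow_def monotone_on_def by blast
qed

text \<open>
  If \<open>F a = 0\<close>, two points of the product whose \<open>i\<close>-th coordinates lie at distance \<open>a i\<close> cannot be
  separated by the aggregated distance, whereas the ball of radius \<open>a i\<close> in the \<open>i\<close>-th factor
  would separate them if \<open>a i\<close> were positive.
\<close>

lemma strongly_aggregation_imp_zero_preimage:
  fixes F :: "('i \<Rightarrow> real) \<Rightarrow> real"
  assumes A: "strongly_aggregation_on_products TYPE('a) K I F"
    and inf: "infinite (UNIV :: 'a set)"
  shows "zero_preimage I F = {zero_pow I}"
proof -
  have main: "F (zero_pow I) = 0 \<and> (F a = 0 \<longrightarrow> (\<forall>i\<in>I. a i = 0))"
    if a: "a \<in> nonneg_pow I" for a
  proof -
    have "\<forall>i\<in>I. \<exists>(X :: 'a set) d x y z. metric_on X d \<and> x \<in> X \<and> y \<in> X \<and> z \<in> X \<and>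
        d x z = 0 \<and> d x y = a i \<and> d y z = a i"
    proof
      fix i assume "i \<in> I"
      then have "0 \<le> a i" using a by (auto simp: nonneg_pow_def PiE_iff)
      then show "\<exists>(X :: 'a set) d x y z. metric_on X d \<and> x \<in> X \<and> y \<in> X \<and> z \<in> X \<and>
          d x z = 0 \<and> d x y = a i \<and> d y z = a i"
        by (intro metric_space_of_triangle_triplet[OF inf]) (simp_all add: triangle_triplet_def)
    qed
    then obtain X :: "'i \<Rightarrow> 'a set" and d x y where
      h: "\<forall>i\<in>I. metric_on (X i) (d i) \<and> x i \<in> X i \<and> y i \<in> X i \<and> d i (x i) (y i) = a i"
      by metis
    then have sp: "\<forall>i\<in>I. is_space K (X i) (d i)"
      using metric_on_imp_is_space by blast
    have qp: "quasi_pseudometric_on (X i) (d i)" if "i \<in> I" for i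
      using sp that is_space_imp_quasi_pseudometric_on by blast
    define x' y' where "x' = restrict x I" and "y' = restrict y I"
    have mem: "x' \<in> Pi\<^sub>E I X" "y' \<in> Pi\<^sub>E I X"
      using h by (auto simp: x'_def y'_def)
    have xy: "dprod I d x' y' = a"
      using h a by (auto simp: x'_def y'_def dprod_def nonneg_pow_def PiE_iff extensional_def fun_eq_iff)
    have qpF: "quasi_pseudometric_on (Pi\<^sub>E I X) (\<lambda>x y. F (dprod I d x y))"
      using A sp is_space_imp_quasi_pseudometric_on
      unfolding strongly_aggregation_on_products_def aggregation_on_products_def by blast
    have top: "product_topology (\<lambda>i. dtopology (X i) (d i)) I =
        dtopology (Pi\<^sub>E I X) (\<lambda>x y. F (dprod I d x y))"
      using A sp unfolding strongly_aggregation_on_products_def by blast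
    have "dprod I d x' x' = zero_pow I"
      using mem quasi_pseudometric_onD(3)[OF qp]
      unfolding dprod_def zero_pow_def by (intro restrict_ext) (auto simp: PiE_iff)
    then have "F (zero_pow I) = 0"
      using quasi_pseudometric_onD(3)[OF qpF mem(1)] by simp
    moreover have "a i = 0" if 0: "F a = 0" and i: "i \<in> I" for i
    proof (rule ccontr)
      assume "a i \<noteq> 0"
      then have pos: "a i > 0" using a i by (force simp: nonneg_pow_def PiE_iff)
      let ?T = "product_topology (\<lambda>i. dtopology (X i) (d i)) I"
      let ?U = "{w \<in> topspace ?T. w i \<in> dball (X i) (d i) (x' i) (a i)}"
      have tT: "topspace ?T = Pi\<^sub>E I X"
        unfolding top by (rule topspace_dtopology[OF qpF])
      have "x' i \<in> X i" using mem i by auto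
      then have "openin ?T ?U"
        by (intro openin_continuous_map_preimage[OF continuous_map_product_projection[OF i]]
            openin_dball[OF qp[OF i]])
      moreover have "x' \<in> ?U"
        using mem centre_in_dball[OF qp[OF i] \<open>x' i \<in> X i\<close> pos] unfolding tT by blast
      ultimately obtain e where "e > 0"
        "dball (Pi\<^sub>E I X) (\<lambda>x y. F (dprod I d x y)) x' e \<subseteq> ?U"
        unfolding top openin_dtopology[OF qpF] by blast
      then have "y' \<in> ?U"
        using mem xy 0 by (auto simp: dball_def)
      then show False
        using h i by (auto simp: dball_def x'_def y'_def)
    qed
    ultimately show ?thesis by blast
  qed
  then show ?thesis
    using zero_pow_in_nonneg_pow[of I] nonneg_pow_eq_zero_pow_iff[of _ I]
    unfolding zero_preimage_eq_iff by blast
qed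

text \<open>
  Every factor is a copy of the nonnegative rationals, a countable and unbounded space, so that
  families of distances to the origin dominate all real families, with the
  strict bounds at finitely many indices retained. The ball of radius \<open>e / 2\<close> absorbs the factor 2
  lost in passing to a dominating family.
\<close>

lemma strongly_aggregation_imp_continuous_at_zero:
  fixes F :: "('i \<Rightarrow> real) \<Rightarrow> real"
  assumes F: "F \<in> nonneg_pow I \<rightarrow> {0..}"
    and A: "strongly_aggregation_on_products TYPE('a) K I F"
    and inf: "infinite (UNIV :: 'a set)"
  shows "continuous_at_zero_pow I F"
proof -
  have P: "preserves_triangle_triplets I F"
    using A aggregation_imp_preserves_triangle_triplets[OF _ inf]
    unfolding strongly_aggregation_on_products_def by blast
  have F0: "F (zero_pow I) = 0"
    using strongly_aggregation_imp_zero_preimage[OF A inf] by (simp add: zero_preimage_eq_iff)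
  obtain f :: "nat \<Rightarrow> 'a" where f: "inj f"
    using infinite_countable_subset[OF inf] by blast
  define h :: "rat \<Rightarrow> 'a" where "h = f \<circ> to_nat"
  have "inj h" unfolding h_def using f by (intro inj_compose inj_to_nat)
  then have inv: "inv h (h q) = q" for q by simp
  define X where "X = (\<lambda>i::'i. h ` {0..})"
  define d where "d = (\<lambda>i::'i. \<lambda>u v. \<bar>real_of_rat (inv h u) - real_of_rat (inv h v)\<bar>)"
  have d: "d i (h q) (h r) = \<bar>real_of_rat q - real_of_rat r\<bar>" for i q r
    by (simp add: d_def inv)
  have "metric_on (X i) (d i)" for i
    unfolding metric_on_def quasi_metric_on_def quasi_pseudometric_on_def X_def ball_simps d
    by (intro conjI ballI impI) (simp_all add: abs_minus_commute)
  then have sp: "\<forall>i\<in>I. is_space K (X i) (d i)"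
    using metric_on_imp_is_space by blast
  have spaces: "\<forall>i\<in>I. quasi_pseudometric_on (X i) (d i)"
    using sp is_space_imp_quasi_pseudometric_on by blast
  then have qp: "quasi_pseudometric_on (X i) (d i)" if "i \<in> I" for i
    using that by blast
  have qpF: "quasi_pseudometric_on (Pi\<^sub>E I X) (\<lambda>x y. F (dprod I d x y))"
    using A sp is_space_imp_quasi_pseudometric_on
    unfolding strongly_aggregation_on_products_def aggregation_on_products_def by blast
  have top: "product_topology (\<lambda>i. dtopology (X i) (d i)) I =
      dtopology (Pi\<^sub>E I X) (\<lambda>x y. F (dprod I d x y))"
    using A sp unfolding strongly_aggregation_on_products_def by blast
  define x where "x = (\<lambda>i\<in>I. h 0)"
  have x: "x \<in> Pi\<^sub>E I X" by (auto simp: x_def X_def)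
  have "\<exists>J \<delta>. finite J \<and> J \<subseteq> I \<and> \<delta> > 0 \<and>
      (\<forall>a\<in>nonneg_pow I. (\<forall>i\<in>J. a i < \<delta>) \<longrightarrow> F a < e)" if e: "e > 0" for e
  proof -
    let ?B = "dball (Pi\<^sub>E I X) (\<lambda>x y. F (dprod I d x y)) x (e / 2)"
    have "openin (product_topology (\<lambda>i. dtopology (X i) (d i)) I) ?B"
      unfolding top by (rule openin_dball[OF qpF x])
    moreover have "x \<in> ?B" using centre_in_dball[OF qpF x] e by simp
    ultimately obtain J \<delta> where J: "finite J" "J \<subseteq> I" "\<delta> > 0"
      and near: "\<forall>y\<in>Pi\<^sub>E I X. (\<forall>i\<in>J. d i (x i) (y i) < \<delta>) \<longrightarrow> y \<in> ?B"
      unfolding openin_product_dtopology[OF spaces] by blast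
    have "F a < e" if a: "a \<in> nonneg_pow I" "\<forall>i\<in>J. a i < \<delta>" for a
    proof -
      have nn: "a i \<ge> 0" if "i \<in> I" for i
        using a(1) that by (auto simp: nonneg_pow_def PiE_iff)
      have "\<forall>i. \<exists>q. a i < real_of_rat q \<and> (i \<in> J \<longrightarrow> real_of_rat q < \<delta>)"
      proof
        fix i
        have "a i < (if i \<in> J then \<delta> else a i + 1)" using a(2) by simp
        from of_rat_dense[OF this] show "\<exists>q. a i < real_of_rat q \<and> (i \<in> J \<longrightarrow> real_of_rat q < \<delta>)"
          by (auto split: if_splits)
      qed
      then obtain q where q: "\<And>i. a i < real_of_rat (q i)" "\<And>i. i \<in> J \<Longrightarrow> real_of_rat (q i) < \<delta>"
        by metis
      have q0: "0 \<le> q i" if "i \<in> I" for i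
      proof -
        have "0 \<le> real_of_rat (q i)" using nn[OF that] q(1)[of i] by linarith
        then show ?thesis by simp
      qed
      define y where "y = (\<lambda>i\<in>I. h (q i))"
      have y: "y \<in> Pi\<^sub>E I X" using q0 by (auto simp: y_def X_def)
      have dxy: "d i (x i) (y i) = real_of_rat (q i)" if "i \<in> I" for i
        using that q0 by (simp add: x_def y_def d)
      have "\<forall>i\<in>J. d i (x i) (y i) < \<delta>" using dxy q(2) J(2) by (simp add: subset_iff)
      then have "y \<in> ?B" using near y by blast
      then have "F (dprod I d x y) < e / 2" by (simp add: dball_def)
      moreover have "F a \<le> 2 * F (dprod I d x y)"
      proof (rule preserves_triangle_triplets_doubling[OF P a(1) dprod_in_nonneg_pow[OF qp x y]])
        show "a i \<le> 2 * dprod I d x y i" if "i \<in> I" for i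
          using that dxy[OF that] q(1)[of i] nn[OF that] by (simp add: dprod_def)
      qed
      ultimately show ?thesis by linarith
    qed
    then show ?thesis
      by (intro exI[of _ J] exI[of _ \<delta>] conjI J) blast
  qed
  then show ?thesis
    unfolding continuous_at_zero_pow_iff[OF F F0] by blast
qed

section \<open>The equivalences\<close>

theorem theorem3p10:
  fixes I :: "'i set" and F :: "('i \<Rightarrow> real) \<Rightarrow> real"
  assumes F: "F \<in> nonneg_pow I \<rightarrow> {0..}"
    and universe: "infinite (UNIV :: 'a set)"
  shows
    "(strongly_aggregation_on_products TYPE('a) Quasi_Metric I F \<longleftrightarrow>
      strongly_aggregation_on_products TYPE('a) Quasi_Pseudometric I F) \<and>
     (strongly_aggregation_on_products TYPE('a) Quasi_Pseudometric I F \<longleftrightarrow>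
      zero_preimage I F = {zero_pow I} \<and> subadditive_pow I F \<and>
      monotone_pow I F \<and> continuous_at_zero_pow I F) \<and>
     (zero_preimage I F = {zero_pow I} \<and> subadditive_pow I F \<and>
      monotone_pow I F \<and> continuous_at_zero_pow I F \<longrightarrow>
      strongly_aggregation_on_products TYPE('a) Metric I F) \<and>
     (strongly_aggregation_on_products TYPE('a) Metric I F \<longleftrightarrow>
      strongly_aggregation_on_products TYPE('a) Pseudometric I F) \<and>
     (strongly_aggregation_on_products TYPE('a) Pseudometric I F \<longleftrightarrow>
      zero_preimage I F = {zero_pow I} \<and> continuous_at_zero_pow I F \<and>
      preserves_triangle_triplets I F)"
proof -
  have necessary: "zero_preimage I F = {zero_pow I} \<and> continuous_at_zero_pow I F \<and>
      preserves_triangle_triplets I F"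
    if "strongly_aggregation_on_products TYPE('a) K I F" for K
    using that strongly_aggregation_imp_zero_preimage[OF that universe]
      strongly_aggregation_imp_continuous_at_zero[OF F that universe]
      aggregation_imp_preserves_triangle_triplets[OF _ universe]
    unfolding strongly_aggregation_on_products_def by blast
  have quasi_necessary: "subadditive_pow I F \<and> monotone_pow I F"
    if A: "strongly_aggregation_on_products TYPE('a) K I F"
      and K: "K \<in> {Quasi_Metric, Quasi_Pseudometric}" for K
  proof -
    have "aggregation_on_products TYPE('a) K I F"
      using A by (simp add: strongly_aggregation_on_products_def)
    moreover have "F (zero_pow I) = 0"
      using necessary[OF A] by (simp add: zero_preimage_eq_iff)
    ultimately show ?thesis
      using quasi_aggregation_imp_subadditive_monotone[OF _ universe K] by blast
  qed
  have quasi_iff: "strongly_aggregation_on_products TYPE('a) K I F \<longleftrightarrow>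
      zero_preimage I F = {zero_pow I} \<and> subadditive_pow I F \<and>
      monotone_pow I F \<and> continuous_at_zero_pow I F"
    if "K \<in> {Quasi_Metric, Quasi_Pseudometric}" for K
    using necessary quasi_necessary that strongly_aggregation_if_subadditive_monotone[OF F] by metis
  have sym_iff: "strongly_aggregation_on_products TYPE('a) K I F \<longleftrightarrow>
      zero_preimage I F = {zero_pow I} \<and> continuous_at_zero_pow I F \<and>
      preserves_triangle_triplets I F"
    if "K \<in> {Metric, Pseudometric}" for K
    using necessary that strongly_aggregation_if_preserves_triangle_triplets[OF F] by metis
  have "strongly_aggregation_on_products TYPE('a) Metric I F"
    if "zero_preimage I F = {zero_pow I} \<and> subadditive_pow I F \<and>
      monotone_pow I F \<and> continuous_at_zero_pow I F"
    using that strongly_aggregation_if_subadditive_monotone[OF F] by blast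
  then show ?thesis
    using quasi_iff[of Quasi_Metric] quasi_iff[of Quasi_Pseudometric]
      sym_iff[of Metric] sym_iff[of Pseudometric] by simp
qed

end
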